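(* Let $b$ be any positive integer and let $c>1-1/e$. There exists $p_0>0$ such that for every $p\in(0,p_0]$ with $b/p$ an integer, no (possibly randomized) online algorithm for the online $b$-matching problem with stochastic rewards is $c$-competitive against the stochastic benchmark $\textsc{SOpt}$ on the class of instances in which every server has capacity $b$ and every edge has success probability exactly $p$; that is, for every such algorithm $\textsc{Alg}$ there is such an instance $G$ with $\mathbb{E}[\textsc{Alg}(G)]<c\cdot\textsc{SOpt}(G)$. In words: even for equal and vanishing edge probabilities, and for every $b$, no online algorithm achieves a competitive ratio greater than $1-1/e$ against $\textsc{SOpt}$.
   Context: Online $b$-matching with stochastic rewards: a bipartite graph $G=(S\cup R,E)$ is given, where the servers $S$ are known in advance and each server may be successfully matched up to $b$ times. Requests $r\in R$ arrive online one by one; on arrival, the edges incident to $r$ and their success probabilities $p_{s,r}\in(0,1]$ are revealed. The algorithm must immediately and irrevocably either assign $r$ to a neighbor that still has remaining capacity, or leave $r$ unassigned. If $r$ is assigned to $s$, the assignment succeeds (is a match) with probability $p_{s,r}$, independently of everything else; a success uses up one unit of the capacity of $s$, while a failure leaves the capacity of $s$ unchanged and $r$ leaves. The objective is the expected number of successful matches; $\mathbb{E}[\textsc{Alg}(G)]$ denotes this for algorithm $\textsc{Alg}$. The stochastic benchmark $\textsc{SOpt}(G)$ is the expected number of matches of an optimal algorithm that knows the entire graph including all edge probabilities in advance, but must still process the requests in arrival order and only learns whether an assignment succeeded after making it. An algorithm is $c$-competitive against $\textsc{SOpt}$ on a class of instances if $\mathbb{E}[\textsc{Alg}(G)]\ge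 c\cdot\textsc{SOpt}(G)$ for all $G$ in the class. *)

theory Defs
  imports "HOL-Probability.Probability"
begin

text \<open>
  Servers are labelled by natural numbers. Requests are labelled by their position
  \<open>0, ..., num_requests G - 1\<close> in the arrival order, so a label tells no more than the
  arrival time.
\<close>

record sr_graph =
  servers :: "nat set"
  num_requests :: nat
  edges :: "(nat \<times> nat) set" \<comment> \<open>pairs (server, request)\<close>
  prob :: "nat \<Rightarrow> nat \<Rightarrow> real" \<comment> \<open>\<open>prob G s r\<close> is only meaningful on edges\<close>

definition sr_instance :: "sr_graph \<Rightarrow> bool" where
  "sr_instance G \<longleftrightarrow>
     finite (servers G) \<and>
     edges G \<subseteq> servers G \<times> {..<num_requests G} \<and>
     (\<forall>(s, r) \<in> edges G. 0 < prob G s r \<and> prob G s r \<le> 1)"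

definition equal_prob_instances :: "real \<Rightarrow> sr_graph set" where
  "equal_prob_instances p =
     {G. sr_instance G \<and> (\<forall>(s, r) \<in> edges G. prob G s r = p)}"

text \<open>
  A history has one entry per processed request: the chosen server (\<open>None\<close> if the request was
  left unassigned) and whether the assignment succeeded. A policy maps the history so far to
  the distribution of the decision for the next request, whose index is the length of the history.
  As a history records all past decisions and outcomes, such behavioural policies are as
  general as policies that draw their random bits in advance.
\<close>

type_synonym history = "(nat option \<times> bool) list"
type_synonym policy = "history \<Rightarrow> nat option pmf"

definition outcome :: "sr_graph \<Rightarrow> nat \<Rightarrow> nat option \<Rightarrow> bool pmf" where
  "outcome G r a =
     (case a of None \<Rightarrow> return_pmf False | Some s \<Rightarrow> bernoulli_pmf (prob G s r))"

primrec run :: "sr_graph \<Rightarrow> policy \<Rightarrow> nat \<Rightarrow> history pmf" where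
  "run G \<pi> 0 = return_pmf []"
| "run G \<pi> (Suc r) =
     bind_pmf (run G \<pi> r) (\<lambda>h.
     bind_pmf (\<pi> h) (\<lambda>a.
     bind_pmf (outcome G r a) (\<lambda>m.
     return_pmf (h @ [(a, m)]))))"

definition used_capacity :: "history \<Rightarrow> nat \<Rightarrow> nat" where
  "used_capacity h s = length (filter (\<lambda>(a, m). a = Some s \<and> m) h)"

definition num_matches :: "history \<Rightarrow> nat" where
  "num_matches h = length (filter snd h)"

definition available :: "nat \<Rightarrow> sr_graph \<Rightarrow> nat \<Rightarrow> history \<Rightarrow> nat set" where
  "available b G r h = {s. (s, r) \<in> edges G \<and> used_capacity h s < b}"

definition feasible :: "nat \<Rightarrow> sr_graph \<Rightarrow> policy \<Rightarrow> bool" where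
  "feasible b G \<pi> \<longleftrightarrow>
     (\<forall>r < num_requests G. \<forall>h \<in> set_pmf (run G \<pi> r).
        set_pmf (\<pi> h) \<subseteq> insert None (Some ` available b G r h))"

definition expected_matches :: "sr_graph \<Rightarrow> policy \<Rightarrow> real" where
  "expected_matches G \<pi> =
     measure_pmf.expectation (run G \<pi> (num_requests G)) (\<lambda>h. real (num_matches h))"

text \<open>
  The policy may depend on all of \<open>G\<close> here. The supremum is over a nonempty
  set (never assigning is feasible) that is bounded above by \<open>num_requests G\<close>.
\<close>

definition SOpt :: "nat \<Rightarrow> sr_graph \<Rightarrow> real" where
  "SOpt b G = (SUP \<pi> \<in> {\<pi>. feasible b G \<pi>}. expected_matches G \<pi>)"

text \<open>
  An online algorithm sees the servers, the incident edges with their probabilities of the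
  requests that have arrived (including the current one), and the history, but neither the
  number of requests nor anything about later ones.
\<close>

type_synonym online_alg = "nat set \<Rightarrow> (nat \<rightharpoonup> real) list \<Rightarrow> policy"

definition revealed :: "sr_graph \<Rightarrow> nat \<Rightarrow> (nat \<rightharpoonup> real)" where
  "revealed G r = (\<lambda>s. if (s, r) \<in> edges G then Some (prob G s r) else None)"

definition policy_of :: "online_alg \<Rightarrow> sr_graph \<Rightarrow> policy" where
  "policy_of alg G h = alg (servers G) (map (revealed G) [0..<Suc (length h)]) h"

definition online_algorithm :: "nat \<Rightarrow> online_alg \<Rightarrow> bool" where
  "online_algorithm b alg \<longleftrightarrow> (\<forall>G. sr_instance G \<longrightarrow> feasible b G (policy_of alg G))"

definition competitive :: "nat \<Rightarrow> real \<Rightarrow> online_alg \<Rightarrow> sr_graph set \<Rightarrow> bool" where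
  "competitive b c alg \<G> \<longleftrightarrow>
     (\<forall>G \<in> \<G>. expected_matches G (policy_of alg G) \<ge> c * SOpt b G)"

end

theory Submission
  imports Defs "HOL-Real_Asymp.Real_Asymp"
begin

text \<open>
  There are \<open>n k\<close> servers and \<open>n\<close> phases of \<open>k b / p\<close> requests each; after every phase the
  adversary retires the \<open>k\<close> alive servers with the least expected use so far, and later requests
  are adjacent to the remaining servers only. An assignment succeeds with probability \<open>p\<close>, so
  phase \<open>j\<close> contributes at most \<open>k b\<close> expected matches and raises the average use of the
  \<open>(n - j) k\<close> alive servers by its \<open>(n - j) k\<close>-th part. This average never exceeds \<open>b\<close>, which
  bounds the online algorithm by \<open>k b (n + 1) (1 - 1/e)\<close>.

  Knowing the blocks of servers retired together, one fills in every phase the servers of the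
  block about to be retired one after the other. The number of matches of a phase is then the
  minimum of \<open>k b\<close> and a binomial variable with mean \<open>k b\<close>, which loses only \<open>O(sqrt (k b))\<close>.
  Taking \<open>n = k\<close> large gives the claim, for every \<open>p \<le> 1\<close>.
\<close>

section \<open>Runs of a policy and their expected counts\<close>

lemma run_SucE:
  assumes "h \<in> set_pmf (run G \<pi> (Suc r))"
  obtains h' a m where "h = h' @ [(a, m)]" "h' \<in> set_pmf (run G \<pi> r)"
    "a \<in> set_pmf (\<pi> h')" "m \<in> set_pmf (outcome G r a)"
  using assms by auto

lemma length_run: "h \<in> set_pmf (run G \<pi> r) \<Longrightarrow> length h = r"
  by (induction r arbitrary: h) (auto elim!: run_SucE simp del: run.simps(2))

text \<open>Lets quantities before and after a request be compared under one measure, that of the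
  longer run.\<close>

lemma map_butlast_run: "map_pmf butlast (run G \<pi> (Suc r)) = run G \<pi> r"
  by (simp add: map_bind_pmf bind_return_pmf')

lemma map_success_run:
  "map_pmf (\<lambda>h. snd (last h)) (run G \<pi> (Suc r)) = run G \<pi> r \<bind> (\<lambda>h. \<pi> h \<bind> outcome G r)"
  by (simp add: map_bind_pmf bind_return_pmf')

lemma used_capacity_le: "used_capacity h s \<le> length h"
  unfolding used_capacity_def by (rule length_filter_le)

lemma num_matches_le: "num_matches h \<le> length h"
  unfolding num_matches_def by (rule length_filter_le)

lemma used_capacity_Nil [simp]: "used_capacity [] s = 0"
  by (simp add: used_capacity_def)

lemma used_capacity_snoc [simp]:
  "used_capacity (h @ [(a, m)]) s = used_capacity h s + (if a = Some s \<and> m then 1 else 0)"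
  by (simp add: used_capacity_def)

lemma num_matches_Nil [simp]: "num_matches [] = 0"
  by (simp add: num_matches_def)

lemma num_matches_snoc [simp]:
  "num_matches (h @ [(a, m)]) = num_matches h + (if m then 1 else 0)"
  by (simp add: num_matches_def)

text \<open>A policy may randomise over infinitely many decisions, so integrability rests on the
  bound by the history length rather than on finite support.\<close>

lemma integrable_run:
  fixes f :: "history \<Rightarrow> real"
  assumes "\<And>h. \<bar>f h\<bar> \<le> real (length h)"
  shows "integrable (measure_pmf (run G \<pi> r)) f"
proof (rule measure_pmf.integrable_const_bound[where B = "real r"])
  show "AE h in measure_pmf (run G \<pi> r). norm (f h) \<le> real r"
    using assms length_run by (metis AE_pmfI real_norm_def)
qed simp

definition mean_used :: "sr_graph \<Rightarrow> policy \<Rightarrow> nat \<Rightarrow> nat \<Rightarrow> real" where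
  "mean_used G \<pi> r s = measure_pmf.expectation (run G \<pi> r) (\<lambda>h. real (used_capacity h s))"

definition mean_matches :: "sr_graph \<Rightarrow> policy \<Rightarrow> nat \<Rightarrow> real" where
  "mean_matches G \<pi> r = measure_pmf.expectation (run G \<pi> r) (\<lambda>h. real (num_matches h))"

lemma expectation_butlast_run:
  fixes f :: "history \<Rightarrow> real"
  shows "measure_pmf.expectation (run G \<pi> (Suc r)) (\<lambda>h. f (butlast h))
    = measure_pmf.expectation (run G \<pi> r) f"
  by (metis integral_map_pmf map_butlast_run)

lemma feasibleD:
  assumes "feasible b G \<pi>" "r < num_requests G" "h \<in> set_pmf (run G \<pi> r)"
    "Some s \<in> set_pmf (\<pi> h)"
  shows "(s, r) \<in> edges G" "used_capacity h s < b"
proof -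
  have "Some s \<in> insert None (Some ` available b G r h)"
    using assms unfolding feasible_def by blast
  thus "(s, r) \<in> edges G" "used_capacity h s < b"
    by (auto simp: available_def)
qed

text \<open>A feasible policy never assigns a request to a non-neighbor. This freezes the use of
  retired servers.\<close>

lemma mean_used_Suc_non_edge:
  assumes "feasible b G \<pi>" "r < num_requests G" "(s, r) \<notin> edges G"
  shows "mean_used G \<pi> (Suc r) s = mean_used G \<pi> r s"
proof -
  have "used_capacity h s = used_capacity (butlast h) s" if "h \<in> set_pmf (run G \<pi> (Suc r))" for h
    using that feasibleD(1)[OF assms(1,2)] assms(3) by (elim run_SucE) auto
  hence "mean_used G \<pi> (Suc r) s =
      measure_pmf.expectation (run G \<pi> (Suc r)) (\<lambda>h. real (used_capacity (butlast h) s))"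
    unfolding mean_used_def by (intro integral_cong_AE) (auto intro: AE_pmfI simp del: run.simps)
  thus ?thesis
    using expectation_butlast_run[where f = "\<lambda>h. real (used_capacity h s)"]
    by (simp add: mean_used_def del: run.simps)
qed

lemma mean_matches_eq_sum:
  assumes "feasible b G \<pi>" "sr_instance G" "r \<le> num_requests G"
  shows "mean_matches G \<pi> r = (\<Sum>s\<in>servers G. mean_used G \<pi> r s)"
proof -
  have fin: "finite (servers G)"
    using assms by (simp add: sr_instance_def)
  have "num_matches h = (\<Sum>s\<in>servers G. used_capacity h s)" if "h \<in> set_pmf (run G \<pi> r)" for h
    using that assms(3)
  proof (induction r arbitrary: h)
    case (Suc r)
    from Suc.prems(1) obtain h' a m where h: "h = h' @ [(a, m)]" "h' \<in> set_pmf (run G \<pi> r)"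
      "a \<in> set_pmf (\<pi> h')" "m \<in> set_pmf (outcome G r a)" by (rule run_SucE)
    have "num_matches h' = (\<Sum>s\<in>servers G. used_capacity h' s)"
      using Suc h by simp
    \<comment> \<open>A success belongs to exactly one server; \<open>None\<close> contributes
      nothing because its outcome is always \<open>False\<close>.\<close>
    moreover have "(if m then 1 else 0) = (\<Sum>s\<in>servers G. if a = Some s \<and> m then 1 else 0 :: nat)"
    proof (cases a)
      case (Some s)
      hence "(s, r) \<in> edges G"
        using h Suc.prems feasibleD(1)[OF assms(1)] by simp
      hence "s \<in> servers G"
        using assms(2) by (auto simp: sr_instance_def)
      thus ?thesis using fin Some by (simp add: sum.delta)
    qed (use h in \<open>auto simp: outcome_def\<close>)
    ultimately show ?case by (simp add: h sum.distrib)
  qed auto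
  hence "mean_matches G \<pi> r = measure_pmf.expectation (run G \<pi> r)
      (\<lambda>h. \<Sum>s\<in>servers G. real (used_capacity h s))"
    unfolding mean_matches_def by (intro integral_cong_AE) (auto intro: AE_pmfI)
  also have "\<dots> = (\<Sum>s\<in>servers G. mean_used G \<pi> r s)"
    unfolding mean_used_def
    by (intro Bochner_Integration.integral_sum integrable_run) (simp add: used_capacity_le)
  finally show ?thesis .
qed

lemma mean_used_le:
  assumes "feasible b G \<pi>" "r \<le> num_requests G"
  shows "mean_used G \<pi> r s \<le> b"
proof -
  have "used_capacity h s \<le> b" if "h \<in> set_pmf (run G \<pi> r)" for h
    using that assms(2)
  proof (induction r arbitrary: h)
    case (Suc r)
    from Suc.prems(1) obtain h' a m where h: "h = h' @ [(a, m)]" "h' \<in> set_pmf (run G \<pi> r)"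
      "a \<in> set_pmf (\<pi> h')" "m \<in> set_pmf (outcome G r a)" by (rule run_SucE)
    have "used_capacity h' s \<le> b" "a = Some s \<Longrightarrow> used_capacity h' s < b"
      using h Suc feasibleD(2)[OF assms(1), of r h' s] by simp_all
    thus ?case by (auto simp: h Suc_le_eq)
  qed auto
  thus ?thesis unfolding mean_used_def
    by (intro measure_pmf.integral_le_const integrable_run) (auto simp: used_capacity_le intro: AE_pmfI)
qed

text \<open>The increment is the probability that the last entry is a success, a mixture of the
  values 0 (unassigned) and \<open>p\<close> (assigned).\<close>

lemma mean_matches_Suc:
  assumes "\<And>s. prob G s r = p" "0 \<le> p" "p \<le> 1"
  shows "mean_matches G \<pi> r \<le> mean_matches G \<pi> (Suc r)"
    and "mean_matches G \<pi> (Suc r) \<le> mean_matches G \<pi> r + p"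
proof -
  let ?M = "run G \<pi> (Suc r)" and ?S = "run G \<pi> r \<bind> (\<lambda>h. \<pi> h \<bind> outcome G r)"
  have int: "integrable (measure_pmf ?M) (\<lambda>h. real (num_matches (butlast h)))"
    by (intro integrable_run) (metis abs_of_nat le_trans length_butlast diff_le_self num_matches_le of_nat_mono)
  have int2: "integrable (measure_pmf ?M) (\<lambda>h. of_bool (snd (last h)) :: real)"
    by (intro measure_pmf.integrable_const_bound[where B = 1]) auto
  have "num_matches h = num_matches (butlast h) + of_bool (snd (last h))" if "h \<in> set_pmf ?M" for h
    using that by (elim run_SucE) auto
  hence "mean_matches G \<pi> (Suc r) = measure_pmf.expectation ?M
      (\<lambda>h. real (num_matches (butlast h)) + of_bool (snd (last h)))"
    unfolding mean_matches_def
    by (intro integral_cong_AE) (auto intro!: AE_pmfI simp del: run.simps)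
  also have "\<dots> = mean_matches G \<pi> r + measure_pmf.expectation ?M (\<lambda>h. of_bool (snd (last h)))"
    using int int2 expectation_butlast_run[where f = "\<lambda>h. real (num_matches h)"]
    by (simp add: mean_matches_def del: run.simps)
  also have "measure_pmf.expectation ?M (\<lambda>h. of_bool (snd (last h)))
      = measure_pmf.expectation (map_pmf (\<lambda>h. snd (last h)) ?M) (of_bool :: bool \<Rightarrow> real)"
    by (simp only: integral_map_pmf)
  also have "map_pmf (\<lambda>h. snd (last h)) ?M = ?S"
    by (rule map_success_run)
  also have "measure_pmf.expectation ?S of_bool = pmf ?S True"
    by (subst integral_measure_pmf[of UNIV]) (auto simp: UNIV_bool)
  finally have eq: "mean_matches G \<pi> (Suc r) = mean_matches G \<pi> r + pmf ?S True" .
  thus "mean_matches G \<pi> r \<le> mean_matches G \<pi> (Suc r)" by simp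
  have le: "pmf (outcome G r a) True \<le> p" for a
    using assms by (auto simp: outcome_def split: option.split)
  have bind_le: "pmf (M \<bind> f) True \<le> p" if "\<And>x. pmf (f x) True \<le> p"
    for M :: "'x pmf" and f
    unfolding pmf_bind
    by (intro measure_pmf.integral_le_const measure_pmf.integrable_const_bound[where B = 1])
      (auto simp: that pmf_le_1)
  have "pmf ?S True \<le> p"
    by (intro bind_le le)
  thus "mean_matches G \<pi> (Suc r) \<le> mean_matches G \<pi> r + p"
    using eq by simp
qed

text \<open>\<open>run\<close> reads probabilities and decisions but no edges, so graphs that differ
  only later are indistinguishable up to time \<open>r\<close>.\<close>

lemma run_cong:
  assumes "\<And>i s. i < r \<Longrightarrow> prob G s i = prob G' s i"
    and "\<And>h. length h < r \<Longrightarrow> \<pi> h = \<pi>' h"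
  shows "run G \<pi> r = run G' \<pi>' r"
  using assms
proof (induction r)
  case (Suc r)
  have "run G \<pi> r = run G' \<pi>' r" using Suc by simp
  moreover have "\<pi> h = \<pi>' h" if "h \<in> set_pmf (run G' \<pi>' r)" for h
    using Suc.prems(2) length_run[OF that] by simp
  moreover have "outcome G r = outcome G' r"
    using Suc.prems(1) by (auto simp: outcome_def fun_eq_iff split: option.split)
  ultimately show ?case by (auto intro: bind_pmf_cong)
qed simp

lemma SOpt_ge:
  assumes "feasible b G \<pi>"
  shows "expected_matches G \<pi> \<le> SOpt b G"
  unfolding SOpt_def
proof (rule cSUP_upper)
  show "bdd_above (expected_matches G ` {\<pi>. feasible b G \<pi>})"
  proof (rule bdd_aboveI2)
    fix \<pi>'
    show "expected_matches G \<pi>' \<le> real (num_requests G)"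
      unfolding expected_matches_def
      by (intro measure_pmf.integral_le_const integrable_run AE_pmfI)
        (use num_matches_le length_run in \<open>auto, metis\<close>)
  qed
qed (use assms in simp)

section \<open>Expectation of a truncated binomial variable\<close>

text \<open>For \<open>p\<close> in [0, 1] this is the expectation of the minimum of
  \<open>j\<close> and a binomial variable with parameters \<open>m\<close> and \<open>p\<close>,
  computed by conditioning on the first trial.\<close>

primrec capped_successes :: "real \<Rightarrow> nat \<Rightarrow> nat \<Rightarrow> real" where
  "capped_successes p 0 j = 0"
| "capped_successes p (Suc m) j =
     (if j = 0 then 0
      else p * (1 + capped_successes p m (j - 1)) + (1 - p) * capped_successes p m j)"

text \<open>
  The right-hand side is the expectation of \<open>X - \<delta>/2 - (X - j)\<^sup>2/(2\<delta>)\<close> for a binomial \<open>X\<close>,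
  and \<open>min X j \<ge> X - \<delta>/2 - (X - j)\<^sup>2/(2\<delta>)\<close> by AM-GM.
\<close>
lemma capped_successes_ge:
  assumes "0 \<le> p" "p \<le> 1" "\<delta> > 0"
  shows "m * p - \<delta> / 2 - ((j - m * p)\<^sup>2 + m * p * (1 - p)) / (2 * \<delta>) \<le> capped_successes p m j"
proof (induction m arbitrary: j)
  case 0
  have "- (\<delta> / 2) \<le> (real j)\<^sup>2 / (2 * \<delta>)"
    by (rule order_trans[of _ 0]) (use assms in simp_all)
  thus ?case by simp
next
  case (Suc m)
  show ?case
  proof (cases "j = 0")
    \<comment> \<open>The value is 0 here, and the bound reduces to the square of \<open>?x\<close>
      minus the parameter being nonnegative.\<close>
    case True
    let ?x = "Suc m * p"
    have "0 \<le> (?x - \<delta>)\<^sup>2 / (2 * \<delta>)" "0 \<le> ?x * (1 - p) / (2 * \<delta>)"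
      using assms by simp_all
    moreover have "(?x - \<delta>)\<^sup>2 / (2 * \<delta>) = ?x\<^sup>2 / (2 * \<delta>) + \<delta> / 2 - ?x"
      using assms by (simp add: field_simps power2_eq_square)
    ultimately have "?x - \<delta> / 2 - (?x\<^sup>2 + ?x * (1 - p)) / (2 * \<delta>) \<le> 0"
      by (simp add: add_divide_distrib)
    thus ?thesis using True by simp
  next
    case False
    let ?L = "\<lambda>m j :: real. m * p - \<delta> / 2 - ((j - m * p)\<^sup>2 + m * p * (1 - p)) / (2 * \<delta>)"
    \<comment> \<open>Being an expectation over a binomial variable, \<open>?L\<close> satisfies the
      recursion with equality.\<close>
    have "?L (Suc m) j = p * (1 + ?L m (real j - 1)) + (1 - p) * ?L m j"
      using assms by (simp add: field_simps power2_eq_square)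
    also have "\<dots> \<le> p * (1 + capped_successes p m (j - 1)) + (1 - p) * capped_successes p m j"
      using assms Suc.IH[of j] Suc.IH[of "j - 1"] False
      by (intro add_mono mult_left_mono) (simp_all add: of_nat_diff)
    finally show ?thesis using False by simp
  qed
qed

text \<open>The parameter \<open>sqrt K\<close> balances the two error terms: the variance is at
  most \<open>K\<close>, so each is at most \<open>sqrt K / 2\<close>.\<close>

lemma capped_successes_ge_sqrt:
  assumes "0 \<le> p" "p \<le> 1" "m * p = real K" "K > 0"
  shows "K - sqrt K \<le> capped_successes p m K"
proof -
  have "K * (1 - p) / (2 * sqrt K) \<le> K / (2 * sqrt K)"
    using assms by (intro divide_right_mono) (auto simp: mult_left_le)
  also have "\<dots> = sqrt K / 2"
    using assms by (simp add: real_div_sqrt flip: divide_divide_eq_left' divide_divide_eq_left)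
  finally show ?thesis
    using capped_successes_ge[of p "sqrt K" m K] assms by simp
qed

text \<open>
  Phase \<open>i\<close> consists of the requests \<open>r\<close> with \<open>r div N = i\<close>, and a server \<open>s\<close> is adjacent to
  the requests of the phases up to \<open>\<beta> s\<close>.
\<close>
definition phase_graph :: "nat \<Rightarrow> nat \<Rightarrow> nat \<Rightarrow> real \<Rightarrow> (nat \<Rightarrow> nat) \<Rightarrow> sr_graph" where
  "phase_graph M n N p \<beta> =
     \<lparr>servers = {..<M}, num_requests = n * N,
      edges = {(s, r). s < M \<and> r < n * N \<and> r div N \<le> \<beta> s}, prob = (\<lambda>_ _. p)\<rparr>"

lemma phase_graph_simps [simp]:
  "servers (phase_graph M n N p \<beta>) = {..<M}"
  "num_requests (phase_graph M n N p \<beta>) = n * N"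
  "(s, r) \<in> edges (phase_graph M n N p \<beta>) \<longleftrightarrow> s < M \<and> r < n * N \<and> r div N \<le> \<beta> s"
  "prob (phase_graph M n N p \<beta>) s r = p"
  by (simp_all add: phase_graph_def)

lemma phase_graph_instance:
  assumes "0 < p" "p \<le> 1"
  shows "phase_graph M n N p \<beta> \<in> equal_prob_instances p" "sr_instance (phase_graph M n N p \<beta>)"
  using assms by (auto simp: equal_prob_instances_def sr_instance_def)

section \<open>A policy filling one block per phase, and a lower bound on
  \<open>SOpt\<close>\<close>

definition block :: "nat \<Rightarrow> (nat \<Rightarrow> nat) \<Rightarrow> nat \<Rightarrow> nat set" where
  "block M \<beta> i = {s. s < M \<and> \<beta> s = i}"

lemma finite_block [simp]: "finite (block M \<beta> i)"
  by (simp add: block_def)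

text \<open>Only servers in their last phase are used, so later blocks stay untouched. Which of them
  is picked is irrelevant: only the total free capacity of the block matters.\<close>

definition block_choice :: "nat \<Rightarrow> nat \<Rightarrow> nat \<Rightarrow> (nat \<Rightarrow> nat) \<Rightarrow> history \<Rightarrow> nat option" where
  "block_choice b M N \<beta> h =
     (if \<exists>s\<in>block M \<beta> (length h div N). used_capacity h s < b
      then Some (SOME s. s \<in> block M \<beta> (length h div N) \<and> used_capacity h s < b) else None)"

lemma block_choice_SomeD:
  assumes "block_choice b M N \<beta> h = Some s"
  shows "s < M" "\<beta> s = length h div N" "used_capacity h s < b"
proof -
  let ?P = "\<lambda>s. s \<in> block M \<beta> (length h div N) \<and> used_capacity h s < b"
  have "\<exists>s. ?P s" "s = (SOME s. ?P s)"
    using assms by (auto simp: block_choice_def split: if_splits)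
  hence "?P s"
    using someI_ex[of ?P] by simp
  thus "s < M" "\<beta> s = length h div N" "used_capacity h s < b"
    by (auto simp: block_def)
qed

definition block_policy :: "nat \<Rightarrow> nat \<Rightarrow> nat \<Rightarrow> (nat \<Rightarrow> nat) \<Rightarrow> policy" where
  "block_policy b M N \<beta> h = return_pmf (block_choice b M N \<beta> h)"

lemma feasible_block_policy:
  "feasible b (phase_graph M n N p \<beta>) (block_policy b M N \<beta>)"
  unfolding feasible_def
proof (intro allI impI ballI)
  fix r h
  assume "r < num_requests (phase_graph M n N p \<beta>)"
    "h \<in> set_pmf (run (phase_graph M n N p \<beta>) (block_policy b M N \<beta>) r)"
  thus "set_pmf (block_policy b M N \<beta> h)
      \<subseteq> insert None (Some ` available b (phase_graph M n N p \<beta>) r h)"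
    using length_run block_choice_SomeD[of b M N \<beta> h]
    by (cases "block_choice b M N \<beta> h") (fastforce simp: block_policy_def available_def)+
qed

text \<open>The state of the dynamic program within phase \<open>i\<close>: each success of the
  block policy lowers it by one, and assignments stop when it is 0.\<close>

definition room :: "nat \<Rightarrow> nat \<Rightarrow> (nat \<Rightarrow> nat) \<Rightarrow> nat \<Rightarrow> history \<Rightarrow> nat" where
  "room b M \<beta> i h = (\<Sum>s\<in>block M \<beta> i. b - used_capacity h s)"

text \<open>The block policy is deterministic, so every step has at most two outcomes and its runs
  have finite support.\<close>

lemma expectation_run_Suc_block_policy:
  fixes f :: "history \<Rightarrow> real" and p :: real and M n N b :: nat and \<beta> :: "nat \<Rightarrow> nat"
  assumes "0 \<le> p" "p \<le> 1"
  defines "G \<equiv> phase_graph M n N p \<beta>" and "c \<equiv> block_choice b M N \<beta>"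
  shows "measure_pmf.expectation (run G (block_policy b M N \<beta>) (Suc r)) f =
    measure_pmf.expectation (run G (block_policy b M N \<beta>) r)
      (\<lambda>h. case c h of None \<Rightarrow> f (h @ [(None, False)])
         | Some s \<Rightarrow> p * f (h @ [(Some s, True)]) + (1 - p) * f (h @ [(Some s, False)]))"
    and "finite (set_pmf (run G (block_policy b M N \<beta>) r))"
proof -
  let ?\<pi> = "block_policy b M N \<beta>"
  let ?k = "\<lambda>h. map_pmf (\<lambda>m. h @ [(c h, m)]) (outcome G r (c h))"
  have step: "run G ?\<pi> (Suc r) = run G ?\<pi> r \<bind> (\<lambda>h. map_pmf (\<lambda>m. h @ [(c h, m)]) (outcome G r (c h)))" for r
    by (simp add: block_policy_def bind_return_pmf map_pmf_def c_def)
  have fin: "finite (set_pmf (run G ?\<pi> r))" for r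
    by (induction r) (auto simp: step simp del: run.simps(2))
  show "finite (set_pmf (run G ?\<pi> r))" by (rule fin)
  have "measure_pmf.expectation (run G ?\<pi> (Suc r)) f = (\<Sum>h\<in>set_pmf (run G ?\<pi> r).
      pmf (run G ?\<pi> r) h *\<^sub>R measure_pmf.expectation (?k h) f)"
    unfolding step by (rule pmf_expectation_bind) (auto simp: fin)
  also have "\<dots> = measure_pmf.expectation (run G ?\<pi> r) (\<lambda>h. measure_pmf.expectation (?k h) f)"
    by (rule integral_measure_pmf[symmetric]) (auto simp: fin)
  also have "(\<lambda>h. measure_pmf.expectation (?k h) f) =
      (\<lambda>h. case c h of None \<Rightarrow> f (h @ [(None, False)])
         | Some s \<Rightarrow> p * f (h @ [(Some s, True)]) + (1 - p) * f (h @ [(Some s, False)]))"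
    using assms(1,2) by (auto simp: outcome_def G_def fun_eq_iff split: option.split)
  finally show "measure_pmf.expectation (run G ?\<pi> (Suc r)) f =
    measure_pmf.expectation (run G ?\<pi> r) (\<lambda>h. case c h of None \<Rightarrow> f (h @ [(None, False)])
         | Some s \<Rightarrow> p * f (h @ [(Some s, True)]) + (1 - p) * f (h @ [(Some s, False)]))" .
qed

lemma room_snoc_failure: "room b M \<beta> i (h @ [(a, False)]) = room b M \<beta> i h"
  by (simp add: room_def)

lemma room_snoc_success:
  assumes "s \<in> block M \<beta> i" "used_capacity h s < b"
  shows "room b M \<beta> i (h @ [(Some s, True)]) = room b M \<beta> i h - 1" "room b M \<beta> i h > 0"
proof -
  have "room b M \<beta> i (h @ [(Some s, True)]) + 1
      = (b - Suc (used_capacity h s)) + 1 + (\<Sum>t\<in>block M \<beta> i - {s}. b - used_capacity h t)"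
    using assms unfolding room_def by (subst sum.remove[of _ s]) auto
  also have "\<dots> = room b M \<beta> i h"
    using assms unfolding room_def by (subst sum.remove[of _ s]) auto
  finally show "room b M \<beta> i (h @ [(Some s, True)]) = room b M \<beta> i h - 1" "room b M \<beta> i h > 0"
    by simp_all
qed

lemma used_capacity_block_policy:
  assumes "h \<in> set_pmf (run G (block_policy b M N \<beta>) r)" "used_capacity h s > 0"
  shows "\<beta> s * N < r"
  using assms
proof (induction r arbitrary: h)
  case (Suc r)
  from Suc.prems(1) obtain h' a m where h: "h = h' @ [(a, m)]"
    "h' \<in> set_pmf (run G (block_policy b M N \<beta>) r)" "a \<in> set_pmf (block_policy b M N \<beta> h')"
    "m \<in> set_pmf (outcome G r a)" by (rule run_SucE)
  show ?case
  proof (cases "used_capacity h' s > 0")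
    case True
    thus ?thesis using Suc.IH h(2) less_SucI by blast
  next
    case False
    hence Some: "block_choice b M N \<beta> h' = Some s"
      using Suc.prems(2) h by (auto simp: block_policy_def split: if_splits)
    thus ?thesis
      using block_choice_SomeD(2)[OF Some] length_run[OF h(2)] by (simp add: less_Suc_eq_le)
  qed
qed simp

text \<open>Backward dynamic programming through the phase: with \<open>m\<close> requests left, the
  matches so far plus the value \<open>capped_successes p m\<close> of the current room have an
  expectation that does not depend on \<open>m\<close>.\<close>

lemma mean_matches_phase_block_policy:
  fixes p :: real and M n N b k i :: nat and \<beta> :: "nat \<Rightarrow> nat"
  assumes "0 \<le> p" "p \<le> 1" "N > 0" and card: "card (block M \<beta> i) = k"
  defines "G \<equiv> phase_graph M n N p \<beta>" and "\<pi> \<equiv> block_policy b M N \<beta>"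
  shows "mean_matches G \<pi> (Suc i * N)
    = mean_matches G \<pi> (i * N) + capped_successes p N (k * b)"
proof -
  have fin: "finite (set_pmf (run G \<pi> r))" for r
    unfolding G_def \<pi>_def using assms by (intro expectation_run_Suc_block_policy(2))
  have eq: "mean_matches G \<pi> (Suc i * N) = measure_pmf.expectation (run G \<pi> (Suc i * N - m))
      (\<lambda>h. num_matches h + capped_successes p m (room b M \<beta> i h))" if "m \<le> N" for m
    using that
  proof (induction m)
    case 0
    show ?case by (simp add: mean_matches_def)
  next
    case (Suc m)
    \<comment> \<open>The request of phase \<open>i\<close> after which exactly \<open>m\<close>
      requests of the phase remain.\<close>
    define r where "r = Suc i * N - Suc m"
    have r: "Suc i * N - m = Suc r" "r div N = i"
      using Suc.prems \<open>N > 0\<close> unfolding r_def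
      by (auto intro!: div_nat_eqI simp: algebra_simps)
    let ?f = "\<lambda>m h. num_matches h + capped_successes p m (room b M \<beta> i h)"
    have "mean_matches G \<pi> (Suc i * N) = measure_pmf.expectation (run G \<pi> (Suc r)) (?f m)"
      using Suc.IH Suc.prems unfolding r(1) by simp
    also have "\<dots> = measure_pmf.expectation (run G \<pi> r)
      (\<lambda>h. case block_choice b M N \<beta> h of None \<Rightarrow> ?f m (h @ [(None, False)])
         | Some s \<Rightarrow> p * ?f m (h @ [(Some s, True)]) + (1 - p) * ?f m (h @ [(Some s, False)]))"
      unfolding G_def \<pi>_def using assms by (intro expectation_run_Suc_block_policy(1))
    also have "\<dots> = measure_pmf.expectation (run G \<pi> r) (?f (Suc m))"
    proof (intro integral_cong_AE AE_pmfI)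
      fix h assume "h \<in> set_pmf (run G \<pi> r)"
      hence len: "length h div N = i" using length_run r by blast
      show "(case block_choice b M N \<beta> h of None \<Rightarrow> ?f m (h @ [(None, False)])
         | Some s \<Rightarrow> p * ?f m (h @ [(Some s, True)]) + (1 - p) * ?f m (h @ [(Some s, False)]))
         = ?f (Suc m) h"
      proof (cases "block_choice b M N \<beta> h")
        \<comment> \<open>The block is full, so the room and the value of the remaining requests are
          both 0.\<close>
        case None
        hence "room b M \<beta> i h = 0"
          by (auto simp: room_def block_choice_def len split: if_splits)
        moreover have "capped_successes p m 0 = 0" by (cases m) auto
        ultimately show ?thesis by (simp add: None room_snoc_failure)
      next
        case (Some s)
        hence "s \<in> block M \<beta> i" "used_capacity h s < b"
          using block_choice_SomeD[OF Some] len by (auto simp: block_def)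
        from room_snoc_success[OF this] show ?thesis
          by (simp add: Some room_snoc_failure algebra_simps)
      qed
    qed simp_all
    finally show ?case by (simp add: r_def)
  qed
  have full: "room b M \<beta> i h = k * b" if "h \<in> set_pmf (run G \<pi> (i * N))" for h
  proof -
    have "used_capacity h s = 0" if "s \<in> block M \<beta> i" for s
      using used_capacity_block_policy[of h G b M N \<beta> "i * N" s] \<open>h \<in> _\<close> that
      by (fastforce simp: \<pi>_def block_def)
    thus ?thesis by (simp add: room_def card)
  qed
  have "mean_matches G \<pi> (Suc i * N) = measure_pmf.expectation (run G \<pi> (i * N))
      (\<lambda>h. num_matches h + capped_successes p N (room b M \<beta> i h))"
    using eq[of N] by simp
  also have "\<dots> = measure_pmf.expectation (run G \<pi> (i * N))
      (\<lambda>h. num_matches h + capped_successes p N (k * b))"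
    using full by (intro integral_cong_AE AE_pmfI) auto
  also have "\<dots> = mean_matches G \<pi> (i * N) + capped_successes p N (k * b)"
    by (subst Bochner_Integration.integral_add)
      (simp_all add: integrable_measure_pmf_finite[OF fin] mean_matches_def)
  finally show ?thesis .
qed

lemma SOpt_phase_graph_ge:
  assumes "0 \<le> p" "p \<le> 1" "N > 0" "N * p = real (k * b)" "k * b > 0"
    and card: "\<And>i. i < n \<Longrightarrow> card (block M \<beta> i) = k"
  shows "n * (real (k * b) - sqrt (real (k * b))) \<le> SOpt b (phase_graph M n N p \<beta>)"
proof -
  let ?G = "phase_graph M n N p \<beta>" and ?\<pi> = "block_policy b M N \<beta>"
  have "mean_matches ?G ?\<pi> (i * N) = i * capped_successes p N (k * b)" if "i \<le> n" for i
    using that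
  proof (induction i)
    case (Suc i)
    thus ?case using mean_matches_phase_block_policy[of p N M \<beta> i k n b] assms
      by (simp add: algebra_simps)
  qed (simp add: mean_matches_def)
  hence "expected_matches ?G ?\<pi> = n * capped_successes p N (k * b)"
    by (simp add: expected_matches_def mean_matches_def)
  moreover have "expected_matches ?G ?\<pi> \<le> SOpt b ?G"
    by (intro SOpt_ge feasible_block_policy)
  moreover have "n * (real (k * b) - sqrt (real (k * b))) \<le> n * capped_successes p N (k * b)"
    using assms by (intro mult_left_mono capped_successes_ge_sqrt) auto
  ultimately show ?thesis by linarith
qed

section \<open>An averaging argument and a linear programming bound\<close>

text \<open>Cut \<open>A\<close> into \<open>m\<close> pieces of size \<open>k\<close>; some piece
  has at most the average sum. Such a piece serves as the set of servers to retire.\<close>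

lemma subset_with_small_sum:
  fixes f :: "'a \<Rightarrow> real"
  assumes "finite A" "card A = m * k" "m > 0"
  obtains B where "B \<subseteq> A" "card B = k" "m * sum f B \<le> sum f A"
proof -
  obtain g where g: "bij_betw g {..<m * k} A"
    using ex_bij_betw_nat_finite[OF assms(1)] assms(2) by (auto simp: atLeast0LessThan)
  let ?I = "\<lambda>i. {i * k..<i * k + k}"
  have sub: "?I i \<subseteq> {..<m * k}" if "i < m" for i
    using mult_le_mono1[of "Suc i" m k] that by auto
  have inj: "inj_on g (?I i)" if "i < m" for i
    using g sub[OF that] by (auto simp: bij_betw_def intro: inj_on_subset)
  have "(\<Sum>i<m. sum f (g ` ?I i)) = (\<Sum>i<m. \<Sum>j\<in>?I i. f (g j))"
    using inj by (intro sum.cong) (simp_all add: sum.reindex)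
  also have "\<dots> = (\<Sum>j<m * k. f (g j))"
    by (rule sum.nat_group)
  also have "\<dots> = sum f A"
    by (rule sum.reindex_bij_betw[OF g])
  finally have sum: "(\<Sum>i<m. sum f (g ` ?I i)) = sum f A" .
  have "\<exists>i<m. m * sum f (g ` ?I i) \<le> sum f A"
  proof (rule ccontr)
    assume "\<not> ?thesis"
    hence "(\<Sum>i<m. sum f A / m) < (\<Sum>i<m. sum f (g ` ?I i))"
      using assms(3) by (intro sum_strict_mono) (auto simp: field_simps not_le)
    thus False using sum assms(3) by simp
  qed
  then obtain i where i: "i < m" "m * sum f (g ` ?I i) \<le> sum f A" by blast
  show ?thesis
  proof
    show "g ` ?I i \<subseteq> A"
      using g sub[OF i(1)] by (auto simp: bij_betw_def)
    show "card (g ` ?I i) = k"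
      by (simp add: card_image inj[OF i(1)])
  qed (fact i(2))
qed

text \<open>
  The left-hand side is compared with the integral of \<open>1 - t / x\<close> from \<open>t\<close> to \<open>n + 1\<close>.
\<close>
lemma sum_truncated_le:
  fixes t :: real
  assumes "t > 0"
  shows "(\<Sum>m<n. max 0 (1 - t / Suc m)) \<le> (n + 1) - t - t * ln ((n + 1) / t)"
proof (induction n)
  case 0
  have "ln (1 / t) \<le> 1 / t - 1"
    using assms by (intro ln_le_minus_one) simp
  hence "t * ln (1 / t) \<le> t * (1 / t - 1)"
    using assms by (intro mult_left_mono) auto
  thus ?case using assms by (simp add: algebra_simps)
next
  case (Suc n)
  show ?case
  proof (cases "Suc n \<le> t")
    \<comment> \<open>All summands vanish, and the right-hand side is nonnegative by
      \<open>ln y \<le> y - 1\<close>.\<close>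
    case True
    have "max 0 (1 - t / Suc m) = 0" if "m < Suc n" for m
    proof -
      have "real (Suc m) \<le> t" using that True by linarith
      thus ?thesis by (simp add: field_simps)
    qed
    hence "(\<Sum>m<Suc n. max 0 (1 - t / Suc m)) = 0"
      by (intro sum.neutral) auto
    moreover have "t * ln ((Suc n + 1) / t) \<le> t * ((Suc n + 1) / t - 1)"
      using assms by (intro mult_left_mono ln_le_minus_one) auto
    moreover have "t * ((Suc n + 1) / t - 1) = Suc n + 1 - t"
      using assms by (simp add: field_simps)
    ultimately show ?thesis by simp
  next
    case False
    let ?x = "real (Suc n)"
    \<comment> \<open>The right-hand side grows by \<open>1 - t * (ln (?x + 1) - ln ?x)\<close>,
      which is at least the new summand \<open>1 - t / ?x\<close>.\<close>
    have "ln (?x + 1) - ln ?x \<le> (?x + 1) / ?x - 1"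
      using ln_le_minus_one[of "(?x + 1) / ?x"] by (simp add: ln_div)
    hence "t * (ln (?x + 1) - ln ?x) \<le> t * (1 / ?x)"
      using assms by (intro mult_left_mono) (auto simp: field_simps)
    moreover have "max 0 (1 - t / ?x) = 1 - t / ?x"
      using False by (simp add: field_simps)
    ultimately show ?thesis using Suc assms by (simp add: ln_div algebra_simps)
  qed
qed

text \<open>Weak linear programming duality, with the multiplier \<open>(n + 1) / e\<close> for the last constraint.\<close>
lemma sum_le_one_minus_inverse_e:
  fixes d :: "nat \<Rightarrow> real"
  assumes "\<And>j. j < n \<Longrightarrow> 0 \<le> d j" "\<And>j. j < n \<Longrightarrow> d j \<le> K"
    and "(\<Sum>j<n. d j / (n - j)) \<le> K" "0 \<le> K"
  shows "(\<Sum>j<n. d j) \<le> K * (n + 1) * (1 - 1 / exp 1)"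
proof -
  define t :: real where "t = (n + 1) / exp 1"
  have t: "t > 0" "(n + 1) / t = exp 1"
    by (simp_all add: t_def)
  have "(\<Sum>j<n. d j) = (\<Sum>j<n. d j * (1 - t / (n - j))) + t * (\<Sum>j<n. d j / (n - j))"
    by (simp add: sum_distrib_left algebra_simps flip: sum.distrib)
  also have "\<dots> \<le> (\<Sum>j<n. K * max 0 (1 - t / (n - j))) + t * K"
  proof (intro add_mono sum_mono)
    fix j assume "j \<in> {..<n}"
    hence "d j * (1 - t / (n - j)) \<le> d j * max 0 (1 - t / (n - j))"
      using assms by (intro mult_left_mono) auto
    also have "\<dots> \<le> K * max 0 (1 - t / (n - j))"
      using assms \<open>j \<in> _\<close> by (intro mult_right_mono) auto
    finally show "d j * (1 - t / (n - j)) \<le> K * max 0 (1 - t / (n - j))" .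
  qed (use assms t in simp)
  also have "(\<Sum>j<n. K * max 0 (1 - t / (n - j))) = K * (\<Sum>m<n. max 0 (1 - t / Suc m))"
    unfolding sum_distrib_left
    by (rule sum.reindex_bij_witness[where i = "\<lambda>m. n - Suc m" and j = "\<lambda>j. n - Suc j"])
      (auto simp: of_nat_diff Suc_diff_Suc)
  also have "K * (\<Sum>m<n. max 0 (1 - t / Suc m)) \<le> K * ((n + 1) - t - t * ln ((n + 1) / t))"
    using assms sum_truncated_le[OF t(1), of n] by (intro mult_left_mono) (auto simp: add.commute)
  \<comment> \<open>By the choice of \<open>t\<close> the logarithm is 1, so its term cancels the
    penalty \<open>t * K\<close>.\<close>
  also have "\<dots> + t * K = K * ((n + 1) - t)"
    unfolding t(2) by (simp add: algebra_simps)
  also have "\<dots> = K * (n + 1) * (1 - 1 / exp 1)"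
    by (simp add: t_def algebra_simps add_divide_distrib)
  finally show ?thesis by simp
qed

section \<open>The adversary and the upper bound for online algorithms\<close>

definition alive :: "nat \<Rightarrow> (nat \<Rightarrow> nat) \<Rightarrow> nat \<Rightarrow> nat set" where
  "alive M \<beta> i = {s. s < M \<and> i \<le> \<beta> s}"

text \<open>Each of the \<open>N\<close> requests adds between 0 and \<open>p\<close> expected
  matches. Servers that are no longer alive have no edges in the phase, so the whole gain goes to
  the alive ones.\<close>

lemma mean_matches_phase:
  fixes p :: real
  assumes "feasible b (phase_graph M n N p \<beta>) \<pi>" "0 < p" "p \<le> 1" "i < n"
  defines "G \<equiv> phase_graph M n N p \<beta>"
  defines "d \<equiv> mean_matches G \<pi> (Suc i * N) - mean_matches G \<pi> (i * N)"
  shows "0 \<le> d" "d \<le> N * p"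
    and "(\<Sum>s\<in>alive M \<beta> i. mean_used G \<pi> (Suc i * N) s)
      = (\<Sum>s\<in>alive M \<beta> i. mean_used G \<pi> (i * N) s) + d"
proof -
  have le: "Suc i * N \<le> n * N" "i * N \<le> n * N"
    using assms by (auto intro: mult_le_mono1 simp del: mult_Suc)
  have inc: "mean_matches G \<pi> (r + m) - mean_matches G \<pi> r \<in> {0..m * p}" for r m
  proof (induction m)
    case (Suc m)
    show ?case
      using Suc mean_matches_Suc[of G "r + m" p \<pi>] assms(2,3)
      by (auto simp: G_def algebra_simps)
  qed simp
  show d: "0 \<le> d" "d \<le> N * p"
    using inc[of "i * N" N] by (simp_all add: d_def add.commute)
  have dead: "mean_used G \<pi> (Suc i * N) s = mean_used G \<pi> (i * N) s"
    if "s \<in> {..<M} - alive M \<beta> i" for s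
  proof -
    have "mean_used G \<pi> (i * N + m) s = mean_used G \<pi> (i * N) s" if "m \<le> N" for m
      using that
    proof (induction m)
      case (Suc m)
      hence "i * N + m < n * N" "(i * N + m) div N = i"
        using le(1) by (auto intro!: div_nat_eqI)
      moreover have "\<beta> s < i"
        using \<open>s \<in> _\<close> by (auto simp: alive_def)
      ultimately have "mean_used G \<pi> (Suc (i * N + m)) s = mean_used G \<pi> (i * N + m) s"
        unfolding G_def using assms(1) by (intro mean_used_Suc_non_edge) auto
      thus ?case using Suc by simp
    qed simp
    from this[of N] show ?thesis by (simp add: add.commute)
  qed
  have split: "mean_matches G \<pi> r = (\<Sum>s\<in>{..<M} - alive M \<beta> i. mean_used G \<pi> r s)
      + (\<Sum>s\<in>alive M \<beta> i. mean_used G \<pi> r s)" if "r \<le> n * N" for r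
  proof -
    have "mean_matches G \<pi> r = (\<Sum>s<M. mean_used G \<pi> r s)"
      using mean_matches_eq_sum[of b G \<pi> r] assms(1) phase_graph_instance[OF assms(2,3)] that
      by (simp add: G_def)
    also have "\<dots> = (\<Sum>s\<in>{..<M} - alive M \<beta> i. mean_used G \<pi> r s)
      + (\<Sum>s\<in>alive M \<beta> i. mean_used G \<pi> r s)"
      by (intro sum.subset_diff) (auto simp: alive_def)
    finally show ?thesis .
  qed
  show "(\<Sum>s\<in>alive M \<beta> i. mean_used G \<pi> (Suc i * N) s)
      = (\<Sum>s\<in>alive M \<beta> i. mean_used G \<pi> (i * N) s) + d"
    using split[of "i * N"] split[of "Suc i * N"] le dead by (simp add: d_def)
qed

text \<open>Through phase \<open>i\<close> the algorithm learns about \<open>\<beta> s\<close> only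
  its minimum with \<open>i\<close>. The adversary may therefore fix later retirement times after
  evaluating the algorithm up to the end of that phase.\<close>

lemma run_phase_graph_cong:
  assumes "\<And>s. min (\<beta> s) i = min (\<beta>' s) i" "r \<le> Suc i * N"
  shows "run (phase_graph M n N p \<beta>) (policy_of alg (phase_graph M n N p \<beta>)) r
    = run (phase_graph M n N p \<beta>') (policy_of alg (phase_graph M n N p \<beta>')) r"
proof (rule run_cong)
  fix h :: history
  assume h: "length h < r"
  have "revealed (phase_graph M n N p \<beta>) q = revealed (phase_graph M n N p \<beta>') q"
    if "q \<le> length h" for q
  proof -
    have "q div N \<le> i"
      using that h assms(2) by (simp add: less_mult_imp_div_less flip: less_Suc_eq_le)
    hence "q div N \<le> \<beta> s \<longleftrightarrow> q div N \<le> \<beta>' s" for s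
      using assms(1)[of s] by (auto simp: min_def split: if_splits)
    thus ?thesis by (simp add: revealed_def fun_eq_iff)
  qed
  thus "policy_of alg (phase_graph M n N p \<beta>) h = policy_of alg (phase_graph M n N p \<beta>') h"
    by (auto simp: policy_of_def intro!: arg_cong2[where f = "\<lambda>x y. alg x y h"])
qed simp

text \<open>
  Retiring the least used servers never lowers the average use of the alive ones; \<open>d j\<close> is the
  expected number of matches in phase \<open>j\<close>.
\<close>
lemma adversary_phases:
  fixes p :: real and n k N b i :: nat and alg :: online_alg
  assumes "online_algorithm b alg" "0 < p" "p \<le> 1" "i < n"
  defines "G \<equiv> phase_graph (n * k) n N p"
  defines "\<pi> \<equiv> \<lambda>\<beta>. policy_of alg (G \<beta>)"
  shows "\<exists>\<beta> d. (\<forall>s. \<beta> s \<le> i) \<and> (\<forall>j<i. card (block (n * k) \<beta> j) = k) \<and>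
    card (block (n * k) \<beta> i) = (n - i) * k \<and>
    (\<forall>j\<le>i. 0 \<le> d j \<and> d j \<le> N * p) \<and>
    mean_matches (G \<beta>) (\<pi> \<beta>) (Suc i * N) = (\<Sum>j\<le>i. d j) \<and>
    (n - i) * (\<Sum>j\<le>i. d j / (n - j)) \<le>
      (\<Sum>s\<in>block (n * k) \<beta> i. mean_used (G \<beta>) (\<pi> \<beta>) (Suc i * N) s)"
  using assms(4)
proof (induction i)
  case 0
  \<comment> \<open>Before any retirement all servers lie provisionally in block 0.\<close>
  let ?\<beta> = "\<lambda>_ :: nat. 0 :: nat"
  have feas: "feasible b (G ?\<beta>) (\<pi> ?\<beta>)"
    using assms phase_graph_instance(2)[OF assms(2,3)] by (auto simp: online_algorithm_def)
  have al: "block (n * k) ?\<beta> 0 = {..<n * k}" "alive (n * k) ?\<beta> 0 = {..<n * k}"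
    by (auto simp: block_def alive_def)
  note step = mean_matches_phase[OF feas[unfolded G_def] assms(2,3) 0, folded G_def]
  have zero: "mean_matches (G ?\<beta>) (\<pi> ?\<beta>) 0 = 0" "mean_used (G ?\<beta>) (\<pi> ?\<beta>) 0 s = 0" for s
    by (simp_all add: mean_matches_def mean_used_def)
  show ?case
    by (rule exI[of _ ?\<beta>], rule exI[of _ "\<lambda>_. mean_matches (G ?\<beta>) (\<pi> ?\<beta>) N"])
      (use 0 step zero in \<open>simp add: al\<close>)
next
  case (Suc i)
  let ?M = "n * k"
  from Suc obtain \<beta> d where le: "\<And>s. \<beta> s \<le> i" and card: "\<And>j. j < i \<Longrightarrow> card (block ?M \<beta> j) = k"
    and cardi: "card (block ?M \<beta> i) = (n - i) * k"
    and d: "\<And>j. j \<le> i \<Longrightarrow> 0 \<le> d j \<and> d j \<le> N * p"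
    and matches: "mean_matches (G \<beta>) (\<pi> \<beta>) (Suc i * N) = (\<Sum>j\<le>i. d j)"
    and used: "(n - i) * (\<Sum>j\<le>i. d j / (n - j)) \<le>
      (\<Sum>s\<in>block ?M \<beta> i. mean_used (G \<beta>) (\<pi> \<beta>) (Suc i * N) s)"
    by auto
  let ?u = "mean_used (G \<beta>) (\<pi> \<beta>) (Suc i * N)" and ?A = "block ?M \<beta> i"
  obtain B where B: "B \<subseteq> ?A" "card B = k" "(n - i) * sum ?u B \<le> sum ?u ?A"
    using subset_with_small_sum[of ?A "n - i" k ?u] cardi Suc.prems by auto
  \<comment> \<open>\<open>B\<close> stays behind as the final block \<open>i\<close>; the survivors
    become the provisional block \<open>Suc i\<close>.\<close>
  define \<beta>' where "\<beta>' = (\<lambda>s. if s \<in> ?A - B then Suc i else \<beta> s)"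
  have finB: "finite B" using B finite_block finite_subset by blast
  have ne: "\<beta> s \<noteq> Suc i" for s
    using le[of s] by simp
  have blocks: "block ?M \<beta>' (Suc i) = ?A - B" "block ?M \<beta>' i = B"
    "\<And>j. j < i \<Longrightarrow> block ?M \<beta>' j = block ?M \<beta> j"
    using B(1) by (auto simp: block_def \<beta>'_def ne split: if_splits)
  have le': "\<beta>' s \<le> Suc i" for s
    using le[of s] by (simp add: \<beta>'_def)
  have alive: "alive ?M \<beta>' (Suc i) = block ?M \<beta>' (Suc i)"
    using le' by (auto simp: alive_def block_def intro: antisym)
  have min: "min (\<beta> s) i = min (\<beta>' s) i" for s
    by (auto simp: \<beta>'_def block_def)
  have run: "run (G \<beta>) (\<pi> \<beta>) (Suc i * N) = run (G \<beta>') (\<pi> \<beta>') (Suc i * N)"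
    unfolding G_def \<pi>_def by (rule run_phase_graph_cong[OF min]) simp
  have same: "mean_used (G \<beta>') (\<pi> \<beta>') (Suc i * N) = ?u"
    "mean_matches (G \<beta>') (\<pi> \<beta>') (Suc i * N) = (\<Sum>j\<le>i. d j)"
    using run matches by (simp_all add: fun_eq_iff mean_used_def mean_matches_def)
  have feas: "feasible b (G \<beta>') (\<pi> \<beta>')"
    using assms phase_graph_instance(2)[OF assms(2,3)] by (auto simp: online_algorithm_def)
  \<comment> \<open>The gain of the new phase: both graphs give the same run up to the end of phase
    \<open>i\<close>.\<close>
  define e where "e = mean_matches (G \<beta>') (\<pi> \<beta>') (Suc (Suc i) * N) - (\<Sum>j\<le>i. d j)"
  note step = mean_matches_phase[OF feas[unfolded G_def] assms(2,3) Suc.prems, folded G_def,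
      unfolded same alive, folded e_def]
  let ?w = "\<Sum>j\<le>i. d j / (n - j)"
  define x where "x = real n - real i"
  have x: "x > 1" "real (n - i) = x" "real (n - Suc i) = x - 1"
    using Suc.prems by (auto simp: x_def)
  have "?w \<le> sum ?u ?A / x"
    using used x(1) by (simp add: x(2) field_simps)
  hence "(x - 1) * ?w \<le> (x - 1) * (sum ?u ?A / x)"
    using x(1) by (intro mult_left_mono) auto
  also have "\<dots> = sum ?u ?A - sum ?u ?A / x"
    using x(1) by (simp add: field_simps)
  also have "\<dots> \<le> sum ?u ?A - sum ?u B"
    using B(3) x(1) by (simp add: x(2) field_simps)
  also have "\<dots> = sum ?u (?A - B)"
    using B(1) by (simp add: sum_diff)
  \<comment> \<open>With \<open>x\<close> groups of size \<open>k\<close> alive, \<open>B\<close>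
    carries at most the fraction \<open>1 / x\<close> of the use. The survivors keep at least
    \<open>x - 1\<close> times the old weighted sum, and the new gain \<open>e\<close> goes to
    them.\<close>
  finally have "(n - Suc i) * (?w + e / (n - Suc i)) \<le> sum ?u (?A - B) + e"
    using x(1) unfolding x(3) by (simp add: distrib_left)
  moreover have "card (?A - B) = (n - Suc i) * k"
    using B finB cardi Suc.prems by (simp add: card_Diff_subset flip: diff_mult_distrib)
      (metis Suc_diff_Suc Suc_lessD add_diff_cancel_left' mult_Suc)
  ultimately show ?case
    by (intro exI[of _ \<beta>'] exI[of _ "d(Suc i := e)"])
      (use le' step d card B in \<open>auto simp: blocks less_Suc_eq e_def le_Suc_eq\<close>)
qed

text \<open>At the last phase \<open>n - 1\<close> a single block of \<open>k\<close> servers is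
  alive, with expected use at most \<open>k * b\<close>. This is the third constraint of the linear
  programming bound.\<close>

lemma adversary:
  fixes p :: real and n k N b :: nat and alg :: online_alg
  assumes "online_algorithm b alg" "0 < p" "p \<le> 1" "n > 0" "N * p = real (k * b)"
  defines "G \<equiv> phase_graph (n * k) n N p"
  obtains \<beta> where "\<And>i. i < n \<Longrightarrow> card (block (n * k) \<beta> i) = k"
    and "expected_matches (G \<beta>) (policy_of alg (G \<beta>)) \<le> k * b * (n + 1) * (1 - 1 / exp 1)"
proof -
  let ?\<pi> = "\<lambda>\<beta>. policy_of alg (G \<beta>)"
  obtain i where n: "n = Suc i" using assms(4) by (cases n) auto
  have ins: "{..i} = {..<n}" using n by auto
  have "i < n" using n by simp
  from adversary_phases[OF assms(1-3) this, of k N, folded G_def]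
  obtain \<beta> d where card: "\<And>j. j < i \<Longrightarrow> card (block (n * k) \<beta> j) = k"
    and cardi: "card (block (n * k) \<beta> i) = (n - i) * k"
    and d: "\<And>j. j \<le> i \<Longrightarrow> 0 \<le> d j \<and> d j \<le> N * p"
    and matches: "mean_matches (G \<beta>) (?\<pi> \<beta>) (Suc i * N) = (\<Sum>j\<le>i. d j)"
    and used: "(n - i) * (\<Sum>j\<le>i. d j / (n - j)) \<le>
      (\<Sum>s\<in>block (n * k) \<beta> i. mean_used (G \<beta>) (?\<pi> \<beta>) (Suc i * N) s)"
    by blast
  have one: "n - i = 1" "Suc i = n"
    using n by simp_all
  have cardi: "card (block (n * k) \<beta> i) = k"
    using cardi unfolding one by simp
  have matches: "mean_matches (G \<beta>) (?\<pi> \<beta>) (n * N) = (\<Sum>j<n. d j)"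
    using matches unfolding one ins .
  have used: "(\<Sum>j<n. d j / (n - j)) \<le>
      (\<Sum>s\<in>block (n * k) \<beta> i. mean_used (G \<beta>) (?\<pi> \<beta>) (n * N) s)"
    using used unfolding one ins by simp
  have d: "0 \<le> d j" "d j \<le> real (k * b)" if "j < n" for j
    using d[of j] that n assms(5) by simp_all
  have "feasible b (G \<beta>) (?\<pi> \<beta>)"
    using assms phase_graph_instance(2)[OF assms(2,3)] by (auto simp: online_algorithm_def)
  hence "(\<Sum>s\<in>block (n * k) \<beta> i. mean_used (G \<beta>) (?\<pi> \<beta>) (n * N) s)
      \<le> card (block (n * k) \<beta> i) * real b"
    by (intro sum_bounded_above mean_used_le) (auto simp: G_def)
  hence "(\<Sum>s\<in>block (n * k) \<beta> i. mean_used (G \<beta>) (?\<pi> \<beta>) (n * N) s) \<le> real (k * b)"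
    by (simp only: cardi of_nat_mult)
  hence "(\<Sum>j<n. d j) \<le> real (k * b) * (n + 1) * (1 - 1 / exp 1)"
    using used d by (intro sum_le_one_minus_inverse_e) auto
  moreover have "expected_matches (G \<beta>) (?\<pi> \<beta>) = (\<Sum>j<n. d j)"
    using matches by (simp add: expected_matches_def mean_matches_def G_def)
  moreover have "card (block (n * k) \<beta> j) = k" if "j < n" for j
    using card[of j] cardi that n by (cases "j = i") simp_all
  ultimately show ?thesis
    by (intro that[of \<beta>]) (simp_all add: algebra_simps)
qed

section \<open>Comparison of the two bounds for many phases\<close>

theorem theorem2p8:
  fixes b :: nat and c :: real
  assumes "b > 0"
    and "c > 1 - 1 / exp 1"
  shows "\<exists>p\<^sub>0 > 0. \<forall>p. 0 < p \<and> p \<le> p\<^sub>0 \<and> real b / p \<in> \<int> \<longrightarrow>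
           (\<forall>alg. online_algorithm b alg \<longrightarrow>
              \<not> competitive b c alg (equal_prob_instances p))"
proof (intro exI[of _ 1] conjI allI impI notI)
  fix p :: real and alg
  assume p: "0 < p \<and> p \<le> 1 \<and> real b / p \<in> \<int>" and alg: "online_algorithm b alg"
    and comp: "competitive b c alg (equal_prob_instances p)"
  let ?e = "1 - 1 / exp 1 :: real"
  have "?e > 0" by simp
  hence c: "c > 0" using assms(2) by linarith
  \<comment> \<open>With \<open>k = n\<close>, these are the upper bound for the algorithm and
    \<open>c\<close> times the lower bound for \<open>SOpt\<close>, both divided by
    \<open>n * (n * b)\<close>. Since \<open>c\<close> exceeds \<open>?e\<close>, the second is
    eventually larger.\<close>
  have "(\<lambda>n. (1 + 1 / real n) * ?e) \<longlonglongrightarrow> (1 + 0) * ?e"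
    by (intro tendsto_intros lim_1_over_n)
  moreover have "(\<lambda>n. c * (1 - 1 / sqrt (real (n * b)))) \<longlonglongrightarrow> c * (1 - 0)"
    using assms(1) by real_asymp
  ultimately have "(\<lambda>n. (1 + 1 / real n) * ?e - c * (1 - 1 / sqrt (real (n * b))))
      \<longlonglongrightarrow> (1 + 0) * ?e - c * (1 - 0)"
    by (rule tendsto_diff)
  hence "eventually (\<lambda>n. (1 + 1 / real n) * ?e - c * (1 - 1 / sqrt (real (n * b))) < 0) sequentially"
    by (rule order_tendstoD(2)) (use assms(2) in simp)
  hence "eventually (\<lambda>n. n > 0 \<and> (1 + 1 / real n) * ?e - c * (1 - 1 / sqrt (real (n * b))) < 0) sequentially"
    by (intro eventually_conj eventually_gt_at_top)
  then obtain n where n: "n > 0" "(1 + 1 / real n) * ?e - c * (1 - 1 / sqrt (real (n * b))) < 0"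
    using eventually_happens'[OF sequentially_bot] by blast
  obtain z where z: "real b / p = of_int z" using p by (auto elim: Ints_cases)
  hence "z > 0" using p assms(1) by (metis divide_pos_pos of_int_0_less_iff of_nat_0_less_iff)
  \<comment> \<open>Integrality of \<open>b / p = z\<close> makes the phase length
    \<open>n * b / p\<close> a natural number, so that \<open>N * p\<close> is exactly the capacity
    \<open>n * b\<close> of a block.\<close>
  define N where "N = n * nat z"
  have N: "N > 0" "N * p = real (n * b)"
    using \<open>z > 0\<close> n z p by (auto simp: N_def field_simps)
  obtain \<beta> where \<beta>: "\<And>i. i < n \<Longrightarrow> card (block (n * n) \<beta> i) = n"
    "expected_matches (phase_graph (n * n) n N p \<beta>) (policy_of alg (phase_graph (n * n) n N p \<beta>))
      \<le> n * b * (n + 1) * ?e"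
    using adversary[of b alg p n N n] alg p n N by auto
  let ?G = "phase_graph (n * n) n N p \<beta>"
  have K: "real (n * b) > 0" using n assms by simp
  have "n * (real (n * b) - sqrt (real (n * b))) \<le> SOpt b ?G"
    using SOpt_phase_graph_ge[of p N n b n "n * n" \<beta>] \<beta>(1) N n p assms(1) by auto
  hence "c * (n * (real (n * b) - sqrt (real (n * b)))) \<le> c * SOpt b ?G"
    using c by (intro mult_left_mono) auto
  also have "\<dots> \<le> expected_matches ?G (policy_of alg ?G)"
    using comp p phase_graph_instance(1)[of p "n * n" n N \<beta>] by (simp add: competitive_def)
  also have "\<dots> \<le> n * b * (n + 1) * ?e"
    by (rule \<beta>(2))
  also have "\<dots> = real n * (n * b) * ((1 + 1 / real n) * ?e)"
    using n by (simp add: field_simps)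
  also have "\<dots> < real n * (n * b) * (c * (1 - 1 / sqrt (real (n * b))))"
    using n K by (intro mult_strict_left_mono) auto
  also have "\<dots> = c * (n * (real (n * b) - real (n * b) / sqrt (real (n * b))))"
    by (simp add: algebra_simps)
  also have "real (n * b) / sqrt (real (n * b)) = sqrt (real (n * b))"
    by (intro real_div_sqrt) simp
  finally show False by simp
qed simp

end
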